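(* Let $m\ge 2$, let $D_{\mathrm r},D_{\mathrm c}\in\mathcal{D}_+^m$, let $Y\sim N_{m\times m}(0,D_{\mathrm r},D_{\mathrm c})$ and $Y_0\sim N_{m\times m}(0,I,I)$, and let $\tilde Y$ and $\tilde Y_0$ be the matrices obtained from $Y$ and $Y_0$, respectively, by replacing all diagonal entries with zeros. Then $T(\tilde Y)$ and $T(\tilde Y_0)$ have the same distribution, where $T$ is the likelihood ratio statistic.
   Context: $\mathcal{D}_+^m$ is the set of $m\times m$ diagonal matrices with positive diagonal entries, and $\mathcal{S}_+^m$ the set of $m\times m$ real symmetric positive definite matrices. $Y\sim N_{m\times m}(0,\Sigma_{\mathrm r},\Sigma_{\mathrm c})$ means $\mathrm{vec}(Y)\sim N_{m^2}(0,\Sigma_{\mathrm c}\otimes\Sigma_{\mathrm r})$, with $\otimes$ the Kronecker product. The scaled log likelihood is $$l(\Sigma_{\mathrm r},\Sigma_{\mathrm c};Y)=\mathrm{tr}\left[\Sigma_{\mathrm r}^{-1}Y\Sigma_{\mathrm c}^{-1}Y^{t}\right]-\log\left|\Sigma_{\mathrm c}^{-1}\otimes\Sigma_{\mathrm r}^{-1}\right|,$$ where $|\cdot|$ is the determinant. For an $m\times m$ matrix $Y$ the likelihood ratio statistic is $$T(Y)=\min_{(D_1,D_2)\in\mathcal{D}_+^m\times\mathcal{D}_+^m}l(D_1,D_2;Y)-\min_{(\Sigma_1,\Sigma_2)\in\mathcal{S}_+^m\times\mathcal{S}_+^m}l(\Sigma_1,\Sigma_2;Y),$$ whenever both minima exist;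 this is the case with probability one for the random matrices in the claim. *)

theory Defs
  imports "HOL-Analysis.Analysis" "HOL-Probability.Probability"
begin

definition pos_diag_matrices :: "(real^'m^'m) set" where
  "pos_diag_matrices = {D. (\<forall>i j. i \<noteq> j \<longrightarrow> D $ i $ j = 0) \<and> (\<forall>i. D $ i $ i > 0)}"

definition pos_def_matrices :: "(real^'m^'m) set" where
  "pos_def_matrices = {A. transpose A = A \<and> (\<forall>x. x \<noteq> 0 \<longrightarrow> x \<bullet> (A *v x) > 0)}"

(* Pairs index the rows and columns of the product; the first component selects the block.
   In vectorize, (j, i) is the position of row i in column j (columns are stacked). *)
definition kronecker :: "real^'n^'m \<Rightarrow> real^'q^'p \<Rightarrow> real^('n \<times> 'q)^('m \<times> 'p)" where
  "kronecker A B = (\<chi> r c. A $ fst r $ fst c * B $ snd r $ snd c)"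

definition vectorize :: "real^'n^'m \<Rightarrow> real^('n \<times> 'm)" where
  "vectorize Y = (\<chi> p. Y $ snd p $ fst p)"

(* The nonsingular normal law: meaningful for positive definite \<Sigma> only. *)
definition mvn_density :: "real^'n \<Rightarrow> real^'n^'n \<Rightarrow> real^'n \<Rightarrow> real" where
  "mvn_density \<mu> \<Sigma> x =
     exp (- ((x - \<mu>) \<bullet> (matrix_inv \<Sigma> *v (x - \<mu>))) / 2) / sqrt ((2 * pi) ^ CARD('n) * det \<Sigma>)"

definition matrix_normal ::
    "'a measure \<Rightarrow> ('a \<Rightarrow> real^'n^'m) \<Rightarrow> real^'n^'m \<Rightarrow> real^'m^'m \<Rightarrow> real^'n^'n \<Rightarrow> bool" where
  "matrix_normal M Y \<mu> \<Sigma>r \<Sigma>c \<longleftrightarrow>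
     distributed M lborel (\<lambda>\<omega>. vectorize (Y \<omega>)) (mvn_density (vectorize \<mu>) (kronecker \<Sigma>c \<Sigma>r))"

definition scaled_loglik :: "real^'m^'m \<Rightarrow> real^'m^'m \<Rightarrow> real^'m^'m \<Rightarrow> real" where
  "scaled_loglik \<Sigma>r \<Sigma>c Y =
     trace (matrix_inv \<Sigma>r ** Y ** matrix_inv \<Sigma>c ** transpose Y)
     - ln (det (kronecker (matrix_inv \<Sigma>c) (matrix_inv \<Sigma>r)))"

definition min_exists :: "('a \<Rightarrow> real) \<Rightarrow> 'a set \<Rightarrow> bool" where
  "min_exists f S \<longleftrightarrow> (\<exists>x. is_arg_min f (\<lambda>x. x \<in> S) x)"

definition min_value :: "('a \<Rightarrow> real) \<Rightarrow> 'a set \<Rightarrow> real" where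
  "min_value f S = f (arg_min_on f S)"

(* The statistic is a partial function: its value is left unspecified
   unless both minima are attained. *)
definition lr_statistic :: "real^'m^'m \<Rightarrow> real" where
  "lr_statistic Y =
     (let l = (\<lambda>(\<Sigma>1, \<Sigma>2). scaled_loglik \<Sigma>1 \<Sigma>2 Y);
          D = pos_diag_matrices \<times> pos_diag_matrices;
          S = pos_def_matrices \<times> pos_def_matrices
      in if min_exists l D \<and> min_exists l S then min_value l D - min_value l S else undefined)"

definition zero_diagonal :: "real^'m^'m \<Rightarrow> real^'m^'m" where
  "zero_diagonal Y = (\<chi> i j. if i = j then 0 else Y $ i $ j)"

end

(* The group of pairs (A, B) of positive diagonal matrices acts by Y -> A Y B on the data and by
   (S, T) -> (A S A, B T B) on the parameters. The likelihood changes by the same additive constant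
   over both parameter spaces, so T is invariant; the action also commutes with zeroing the
   diagonal, and it carries N(0, I, I) to N(0, D_r, D_c).

   Measurability needs no almost sure existence of the minima. Both parameter spaces are
   sigma-compact and the likelihood is jointly continuous, so the data for which a minimum is
   attained form a countable union of projections, along compact sets, of closed sets; on that set
   the minimum is an infimum of continuous functions. *)

theory Submission imports Defs begin

section \<open>Inverses, determinants and Kronecker products\<close>

lemma matrix_inv_eqI:
  fixes A B :: "real^'n^'n"
  assumes "A ** B = mat 1"
  shows "matrix_inv A = B"
proof -
  have BA: "B ** A = mat 1"
    using assms by (simp add: matrix_left_right_inverse)
  have "A ** matrix_inv A = mat 1 \<and> matrix_inv A ** A = mat 1"
    unfolding matrix_inv_def by (rule someI[of _ B]) (simp add: assms BA)
  then have "B ** (A ** matrix_inv A) = B"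
    by simp
  then show ?thesis
    by (simp add: matrix_mul_assoc BA)
qed

lemma matrix_inv_right:
  fixes A :: "real^'n^'n"
  assumes "det A \<noteq> 0"
  shows "A ** matrix_inv A = mat 1"
proof -
  obtain B where "A ** B = mat 1"
    using assms by (metis invertible_det_nz invertible_def)
  then show ?thesis
    using matrix_inv_eqI by metis
qed

text \<open>Column \<open>l\<close> of the inverse solves a linear system with right-hand side
  \<open>axis l 1\<close>, so Cramer's rule applies. Entries of the inverse become quotients of
  polynomials in the entries of \<open>A\<close>, which makes inversion continuous wherever the
  determinant does not vanish.\<close>

lemma matrix_inv_nth_cramer:
  fixes A :: "real^'n^'n"
  assumes "det A \<noteq> 0"
  shows "matrix_inv A $ k $ l = det (\<chi> i j. if j = k then axis l 1 $ i else A $ i $ j) / det A"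
proof -
  have "A *v (matrix_inv A *v axis l 1) = axis l 1"
    using assms by (simp add: matrix_vector_mul_assoc matrix_inv_right)
  then have "(matrix_inv A *v axis l 1) $ k
      = det (\<chi> i j. if j = k then axis l 1 $ i else A $ i $ j) / det A"
    using cramer[OF assms, of "matrix_inv A *v axis l 1" "axis l 1"] by simp
  then show ?thesis
    by (simp add: matrix_vector_mul_component inner_axis)
qed

lemma continuous_on_det [continuous_intros]:
  fixes f :: "'a::topological_space \<Rightarrow> real^'n^'n"
  assumes "continuous_on S f"
  shows "continuous_on S (\<lambda>x. det (f x))"
  unfolding det_def by (intro continuous_intros assms)

lemma continuous_on_matrix_inv [continuous_intros]:
  fixes f :: "'a::topological_space \<Rightarrow> real^'n^'n"
  assumes f: "continuous_on S f" and nz: "\<And>x. x \<in> S \<Longrightarrow> det (f x) \<noteq> 0"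
  shows "continuous_on S (\<lambda>x. matrix_inv (f x))"
proof -
  have comp: "continuous_on S (\<lambda>x. if j = k then axis l (1::real) $ i else f x $ i $ j)" for i j k l
    by (cases "j = k") (auto intro!: continuous_intros f)
  have "continuous_on S (\<lambda>x. \<chi> k l.
      det (\<chi> i j. if j = k then axis l 1 $ i else f x $ i $ j) / det (f x))"
    by (intro continuous_intros f comp) (use nz in auto)
  then show ?thesis
    by (rule continuous_on_eq) (simp add: vec_eq_iff nz matrix_inv_nth_cramer)
qed

lemma continuous_on_matrix_mult [continuous_intros]:
  fixes f :: "'a::topological_space \<Rightarrow> real^'n^'m" and g :: "'a \<Rightarrow> real^'p^'n"
  assumes "continuous_on S f" "continuous_on S g"
  shows "continuous_on S (\<lambda>x. f x ** g x)"
  unfolding matrix_matrix_mult_def by (intro continuous_intros assms)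

lemma continuous_on_kronecker [continuous_intros]:
  fixes f :: "'a::topological_space \<Rightarrow> real^'n^'m" and g :: "'a \<Rightarrow> real^'q^'p"
  assumes "continuous_on S f" "continuous_on S g"
  shows "continuous_on S (\<lambda>x. kronecker (f x) (g x))"
  unfolding kronecker_def by (intro continuous_intros assms)

lemma kronecker_mult:
  fixes A :: "real^'n^'m" and B :: "real^'k^'n" and C :: "real^'q^'p" and D :: "real^'r^'q"
  shows "kronecker A C ** kronecker B D = kronecker (A ** B) (C ** D)"
  by (simp add: vec_eq_iff kronecker_def matrix_matrix_mult_def sum_product
      flip: UNIV_Times_UNIV sum.cartesian_product) (simp add: sum.cartesian_product split_beta mult_ac)

lemma kronecker_mat_1: "kronecker (mat 1 :: real^'n^'n) (mat 1 :: real^'m^'m) = mat 1"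
  by (simp add: vec_eq_iff kronecker_def mat_def prod_eq_iff)

lemma det_nonzeroI:
  fixes A B :: "real^'n^'n"
  assumes "A ** B = mat 1"
  shows "det A \<noteq> 0"
  by (metis assms det_I det_mul mult_zero_left zero_neq_one)

text \<open>By the mixed-product rule the Kronecker product of the inverses is an inverse; this
  bypasses the formula for the determinant of a Kronecker product.\<close>

lemma det_kronecker_nonzero:
  fixes A :: "real^'n^'n" and B :: "real^'m^'m"
  assumes "det A \<noteq> 0" "det B \<noteq> 0"
  shows "det (kronecker A B) \<noteq> 0"
  by (rule det_nonzeroI[of _ "kronecker (matrix_inv A) (matrix_inv B)"])
    (simp add: kronecker_mult matrix_inv_right kronecker_mat_1 assms)

lemma det_matrix_inv_nonzero:
  fixes A :: "real^'n^'n"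
  assumes "det A \<noteq> 0"
  shows "det (matrix_inv A) \<noteq> 0"
  using matrix_inv_right[OF assms] by (metis det_nonzeroI matrix_left_right_inverse)

section \<open>Positive definite and positive diagonal matrices: continuity of the likelihood,
  compact exhaustion\<close>

lemma pos_def_det_nonzero:
  fixes A :: "real^'n^'n"
  assumes "A \<in> pos_def_matrices"
  shows "det A \<noteq> 0"
proof -
  have "A *v x = 0 \<Longrightarrow> x = 0" for x
    using assms unfolding pos_def_matrices_def by force
  then show ?thesis
    by (metis matrix_left_invertible_ker invertible_left_inverse invertible_det_nz)
qed

lemma continuous_on_scaled_loglik:
  "continuous_on ((pos_def_matrices \<times> pos_def_matrices) \<times> UNIV)
    (\<lambda>(p, Y). scaled_loglik (fst p) (snd p) (Y :: real^'m^'m))"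
proof -
  have nz: "det (fst (fst z)) \<noteq> 0" "det (snd (fst z)) \<noteq> 0"
    if "z \<in> (pos_def_matrices \<times> pos_def_matrices) \<times> UNIV" for z :: "((real^'m^'m) \<times> (real^'m^'m)) \<times> (real^'m^'m)"
    using that by (auto dest: pos_def_det_nonzero)
  show ?thesis
    unfolding scaled_loglik_def split_beta trace_def transpose_def
    by (intro continuous_intros ballI det_kronecker_nonzero det_matrix_inv_nonzero nz)
qed

text \<open>The diagonal parameter space is cut out of the positive definite cone by closed linear
  conditions, so it inherits both the continuity of the likelihood and the compact
  exhaustion.\<close>

lemma pos_diag_eq_pos_def_Int:
  "pos_diag_matrices = pos_def_matrices \<inter> {D :: real^'m^'m. \<forall>i j. i \<noteq> j \<longrightarrow> D $ i $ j = 0}"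
proof -
  have "D \<in> pos_def_matrices" if D: "D \<in> pos_diag_matrices" for D :: "real^'m^'m"
  proof -
    have off: "D $ i $ j = (if i = j then D $ i $ i else 0)" for i j
      using D by (auto simp: pos_diag_matrices_def)
    have "x \<bullet> (D *v x) = (\<Sum>i\<in>UNIV. D $ i $ i * (x $ i)\<^sup>2)" for x
      by (simp add: inner_vec_def matrix_vector_mult_def)
        (subst off, simp add: if_distrib if_distribR power2_eq_square mult_ac cong: if_cong)
    moreover have "(\<Sum>i\<in>UNIV. D $ i $ i * (x $ i)\<^sup>2) > 0" if nz: "x \<noteq> 0" for x
    proof -
      obtain k where "x $ k \<noteq> 0"
        using nz by (metis vec_eq_iff zero_index)
      then show ?thesis
        using D by (intro sum_pos2[of _ k]) (auto simp: pos_diag_matrices_def less_imp_le)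
    qed
    moreover have "transpose D = D"
      unfolding transpose_def vec_eq_iff using D by (auto simp: pos_diag_matrices_def) metis
    ultimately show ?thesis
      by (simp add: pos_def_matrices_def)
  qed
  moreover have "D $ i $ i > 0" if "D \<in> pos_def_matrices" for D :: "real^'m^'m" and i
  proof -
    \<comment> \<open>The coordinate vector as test vector reads off the diagonal entry.\<close>
    have "axis i 1 \<bullet> (D *v axis i 1) > 0"
      using that by (simp add: pos_def_matrices_def axis_eq_0_iff)
    then show ?thesis
      by (simp add: inner_axis' matrix_vector_mul_component inner_axis)
  qed
  ultimately show ?thesis
    by (auto simp: pos_diag_matrices_def)
qed

text \<open>For symmetric \<open>A\<close> and positive \<open>n\<close>: norm at most
  \<open>n\<close> and smallest eigenvalue at least \<open>1 / n\<close>. The eigenvalue bound is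
  multiplied out, so that for \<open>n = 0\<close> it fails at every nonzero \<open>x\<close> and
  the piece is empty. All conditions are non-strict, hence closed.\<close>

definition pos_def_exhaustion :: "nat \<Rightarrow> (real^'m^'m) set" where
  "pos_def_exhaustion n = cball 0 (real n) \<inter>
     {A. transpose A = A \<and> (\<forall>x. x \<bullet> x \<le> real n * (x \<bullet> (A *v x)))}"

lemma closed_Collect_quadratic_form:
  "closed {A :: real^'m^'m. transpose A = A \<and> (\<forall>x. x \<bullet> x \<le> c * (x \<bullet> (A *v x)))}"
  unfolding transpose_def matrix_vector_mult_def
  by (intro closed_Collect_conj closed_Collect_eq closed_Collect_all closed_Collect_le continuous_intros)

lemma compact_pos_def_exhaustion: "compact (pos_def_exhaustion n)"
  unfolding pos_def_exhaustion_def
  by (intro compact_Int_closed compact_cball closed_Collect_quadratic_form)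

lemma pos_def_eq_UN_exhaustion: "pos_def_matrices = (\<Union>n. pos_def_exhaustion n :: (real^'m^'m) set)"
proof (intro equalityI subsetI)
  fix A :: "real^'m^'m"
  assume A: "A \<in> pos_def_matrices"
  \<comment> \<open>The form attains its minimum \<open>e\<close> on the unit sphere, and
    definiteness makes \<open>e\<close> positive. As the form is homogeneous of degree two,
    \<open>e\<close> bounds it from below by a multiple of the squared norm everywhere.\<close>
  let ?S = "sphere 0 1 :: (real^'m) set"
  have cont: "continuous_on ?S (\<lambda>x. x \<bullet> (A *v x))"
    unfolding matrix_vector_mult_def by (intro continuous_intros)
  have "axis undefined 1 \<in> ?S"
    by simp
  then obtain u where u: "u \<in> ?S" and umin: "\<And>x. x \<in> ?S \<Longrightarrow> u \<bullet> (A *v u) \<le> x \<bullet> (A *v x)"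
    using continuous_attains_inf[OF compact_sphere _ cont] by blast
  define e where "e = u \<bullet> (A *v u)"
  have e: "e > 0"
  proof -
    have "u \<noteq> 0"
      using u by auto
    then show ?thesis
      using A by (simp add: e_def pos_def_matrices_def)
  qed
  have lower: "e * (x \<bullet> x) \<le> x \<bullet> (A *v x)" for x
  proof (cases "x = 0")
    case False
    have "e \<le> (x /\<^sub>R norm x) \<bullet> (A *v (x /\<^sub>R norm x))"
      unfolding e_def by (rule umin) (use False in simp)
    also have "\<dots> = (x \<bullet> (A *v x)) / (x \<bullet> x)"
      by (simp add: matrix_vector_mult_scaleR dot_square_norm power2_eq_square field_simps)
    finally show ?thesis
      using False by (simp add: field_simps)
  qed simp
  obtain n where n: "real n \<ge> max (1 / e) (norm A)"
    using real_arch_simple by blast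
  have "x \<bullet> x \<le> real n * (x \<bullet> (A *v x))" for x
  proof -
    have "x \<bullet> x \<le> (1 / e) * (x \<bullet> (A *v x))"
      using lower[of x] e by (simp add: field_simps)
    also have "\<dots> \<le> real n * (x \<bullet> (A *v x))"
      using n lower[of x] e by (intro mult_right_mono) (auto intro: order_trans[rotated])
    finally show ?thesis .
  qed
  then show "A \<in> (\<Union>n. pos_def_exhaustion n)"
    using n A by (auto simp: pos_def_exhaustion_def pos_def_matrices_def)
next
  fix A :: "real^'m^'m"
  assume "A \<in> (\<Union>n. pos_def_exhaustion n)"
  then obtain n where sym: "transpose A = A"
    and le: "\<And>x. x \<bullet> x \<le> real n * (x \<bullet> (A *v x))"
    by (auto simp: pos_def_exhaustion_def)
  have "x \<bullet> (A *v x) > 0" if "x \<noteq> 0" for x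
  proof -
    have "real n * (x \<bullet> (A *v x)) > 0"
      using le[of x] that by (meson inner_gt_zero_iff less_le_trans)
    then show ?thesis
      by (simp add: zero_less_mult_iff)
  qed
  then show "A \<in> pos_def_matrices"
    by (simp add: sym pos_def_matrices_def)
qed

section \<open>Measurability of minima over sigma-compact parameter sets\<close>

lemma min_exists_iff: "min_exists f S \<longleftrightarrow> (\<exists>x\<in>S. \<forall>y\<in>S. f x \<le> f y)"
  for f :: "'a \<Rightarrow> real"
  unfolding min_exists_def is_arg_min_def by (auto simp: not_less)

lemma min_value_eqI:
  assumes "x \<in> S" "\<And>y. y \<in> S \<Longrightarrow> f x \<le> f y"
  shows "min_value f S = f x"
  unfolding min_value_def arg_min_on_def by (rule arg_min_equality) (use assms in auto)

text \<open>Turns a strict sublevel set of the minimum into a union over parameters, where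
  continuity in the data makes each member open.\<close>

lemma min_value_less_iff:
  assumes "min_exists f S"
  shows "min_value f S < c \<longleftrightarrow> (\<exists>x\<in>S. f x < c)"
proof -
  obtain x where x: "x \<in> S" "\<And>y. y \<in> S \<Longrightarrow> f x \<le> f y"
    using assms by (auto simp: min_exists_iff)
  then have "min_value f S = f x"
    by (rule min_value_eqI)
  then show ?thesis
    using x by (auto intro: le_less_trans)
qed

context
  fixes l :: "'p::euclidean_space \<Rightarrow> 'y::euclidean_space \<Rightarrow> real" and S :: "'p set"
    and K :: "'i::countable \<Rightarrow> 'p set"
  assumes cont: "continuous_on (S \<times> UNIV) (\<lambda>(p, y). l p y)"
    and compact: "\<And>n. compact (K n)" and S: "S = (\<Union>n. K n)"
begin

text \<open>\<open>T n\<close> collects the pairs whose parameter lies in \<open>K n\<close> and is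
  minimal against all of \<open>S\<close>, not merely against \<open>K n\<close>. The intersection
  over uncountably many competitors \<open>q\<close> is harmless because every member is closed;
  projecting away the compact factor \<open>K n\<close> keeps closedness, and only the union over
  \<open>n\<close> has to be countable.\<close>

lemma sets_min_exists: "{y. min_exists (\<lambda>p. l p y) S} \<in> sets borel"
proof -
  define T where "T n = (\<Inter>q\<in>S. {z \<in> K n \<times> UNIV. l (fst z) (snd z) \<le> l q (snd z)})" for n
  have T: "closed ((K n \<times> UNIV) \<inter> T n)" for n
  proof -
    have "closed {z \<in> K n \<times> UNIV. l (fst z) (snd z) \<le> l q (snd z)}" if q: "q \<in> S" for q
    proof (rule continuous_on_closed_Collect_le)
      show "continuous_on (K n \<times> UNIV) (\<lambda>z. l (fst z) (snd z))"
        using continuous_on_subset[OF cont, of "K n \<times> UNIV"] S by (auto simp: split_beta)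
      show "continuous_on (K n \<times> UNIV) (\<lambda>z. l q (snd z))"
        using continuous_on_compose2[OF cont, of "K n \<times> UNIV" "\<lambda>z. (q, snd z)"] q
        by (simp add: continuous_on_Pair image_subset_iff continuous_on_snd)
      show "closed (K n \<times> (UNIV :: 'y set))"
        by (intro closed_Times compact_imp_closed compact closed_UNIV)
    qed
    then show ?thesis
      unfolding T_def
      by (intro closed_Int closed_INT ballI closed_Times compact_imp_closed[OF compact] closed_UNIV)
  qed
  have "{y. min_exists (\<lambda>p. l p y) S} = (\<Union>n. {y. \<exists>p. p \<in> K n \<and> (p, y) \<in> (K n \<times> UNIV) \<inter> T n})"
    by (auto simp: min_exists_iff T_def S)
  also have "\<dots> \<in> sets borel"
    by (intro sets.countable_UN image_subsetI borel_closed closed_compact_projection compact T)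
  finally show ?thesis .
qed

lemma measurable_min_value:
  "(\<lambda>y. if min_exists (\<lambda>p. l p y) S then min_value (\<lambda>p. l p y) S else 0) \<in> borel_measurable borel"
proof (rule borel_measurable_iff_less[THEN iffD2], rule allI)
  fix c :: real
  let ?E = "{y. min_exists (\<lambda>p. l p y) S}"
  have "open {y. l p y < c}" if "p \<in> S" for p
  proof -
    have "continuous_on UNIV (l p)"
      using continuous_on_compose2[OF cont, of UNIV "\<lambda>y. (p, y)"] that
      by (simp add: continuous_on_Pair image_subset_iff)
    then show ?thesis
      by (intro open_Collect_less continuous_intros)
  qed
  then have "(\<Union>p\<in>S. {y. l p y < c}) \<in> sets borel"
    by (intro borel_open open_UN) auto
  \<comment> \<open>Where the minimum exists, the sublevel set is a union of open sets, which may be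
    uncountable. Elsewhere the default value 0 lies below \<open>c\<close> exactly when
    \<open>0 < c\<close>.\<close>
  moreover have "{y \<in> space borel. (if min_exists (\<lambda>p. l p y) S then min_value (\<lambda>p. l p y) S else 0) < c}
      = (?E \<inter> (\<Union>p\<in>S. {y. l p y < c})) \<union> (if 0 < c then - ?E else {})"
    by (auto simp: min_value_less_iff split: if_splits)
  ultimately show "{y \<in> space borel. (if min_exists (\<lambda>p. l p y) S then min_value (\<lambda>p. l p y) S else 0) < c}
      \<in> sets borel"
    using sets_min_exists by (auto intro!: sets.Int sets.Un borel_comp)
qed

end


section \<open>Measurability of the statistic\<close>

lemma pos_diag_eq_UN_exhaustion:
  "pos_diag_matrices =
    (\<Union>n. pos_def_exhaustion n \<inter> {D :: real^'m^'m. \<forall>i j. i \<noteq> j \<longrightarrow> D $ i $ j = 0})"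
  by (simp add: pos_diag_eq_pos_def_Int pos_def_eq_UN_exhaustion)

lemma compact_pos_diag_exhaustion:
  "compact (pos_def_exhaustion n \<inter> {D :: real^'m^'m. \<forall>i j. i \<noteq> j \<longrightarrow> D $ i $ j = 0})"
  by (intro compact_Int_closed compact_pos_def_exhaustion closed_Collect_all closed_Collect_imp
      open_Collect_const closed_Collect_eq continuous_intros)

lemma scaled_loglik_min_measurable:
  fixes K :: "nat \<Rightarrow> (real^'m^'m) set"
  assumes S: "S = (\<Union>n. K n)" "S \<subseteq> pos_def_matrices" and K: "\<And>n. compact (K n)"
  shows sets_scaled_loglik_min_exists:
      "{Y. min_exists (\<lambda>(A, B). scaled_loglik A B Y) (S \<times> S)} \<in> sets borel"
    and measurable_scaled_loglik_min_value:
      "(\<lambda>Y. if min_exists (\<lambda>(A, B). scaled_loglik A B Y) (S \<times> S)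
         then min_value (\<lambda>(A, B). scaled_loglik A B Y) (S \<times> S) else 0) \<in> borel_measurable borel"
proof -
  have eq: "(\<lambda>(A, B). scaled_loglik A B Y) = (\<lambda>p. scaled_loglik (fst p) (snd p) Y)" for Y :: "real^'m^'m"
    by (simp add: case_prod_unfold)
  have cont: "continuous_on ((S \<times> S) \<times> UNIV) (\<lambda>(p, Y). scaled_loglik (fst p) (snd p) (Y :: real^'m^'m))"
    by (rule continuous_on_subset[OF continuous_on_scaled_loglik]) (use S in auto)
  \<comment> \<open>The two factors are exhausted independently, so the pieces are indexed by pairs
    of naturals.\<close>
  have comp: "compact (case i of (a, b) \<Rightarrow> K a \<times> K b)" for i
    by (simp add: split_beta compact_Times K)
  have UN: "S \<times> S = (\<Union>i. case i of (a, b) \<Rightarrow> K a \<times> K b)"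
    by (auto simp: S(1))
  show "{Y. min_exists (\<lambda>(A, B). scaled_loglik A B Y) (S \<times> S)} \<in> sets borel"
    using sets_min_exists[OF cont comp UN] unfolding eq .
  show "(\<lambda>Y. if min_exists (\<lambda>(A, B). scaled_loglik A B Y) (S \<times> S)
         then min_value (\<lambda>(A, B). scaled_loglik A B Y) (S \<times> S) else 0) \<in> borel_measurable borel"
    using measurable_min_value[OF cont comp UN] unfolding eq .
qed

lemma borel_measurable_lr_statistic [measurable]:
  "(lr_statistic :: real^'m^'m \<Rightarrow> real) \<in> borel_measurable borel"
proof -
  let ?l = "\<lambda>Y (A, B). scaled_loglik A B (Y :: real^'m^'m)"
  let ?D = "pos_diag_matrices \<times> pos_diag_matrices :: ((real^'m^'m) \<times> (real^'m^'m)) set"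
  let ?S = "pos_def_matrices \<times> pos_def_matrices :: ((real^'m^'m) \<times> (real^'m^'m)) set"
  let ?v = "\<lambda>R Y. if min_exists (?l Y) R then min_value (?l Y) R else 0"
  have sub: "(pos_diag_matrices :: (real^'m^'m) set) \<subseteq> pos_def_matrices"
    by (simp add: pos_diag_eq_pos_def_Int)
  note D = scaled_loglik_min_measurable[OF pos_diag_eq_UN_exhaustion sub compact_pos_diag_exhaustion]
  note S = scaled_loglik_min_measurable[OF pos_def_eq_UN_exhaustion order_refl compact_pos_def_exhaustion]
  have [measurable]: "?v ?D \<in> borel_measurable borel" "?v ?S \<in> borel_measurable borel"
    using D(2) S(2) by simp_all
  have [measurable]: "Measurable.pred borel (\<lambda>Y. min_exists (?l Y) ?D)"
      "Measurable.pred borel (\<lambda>Y. min_exists (?l Y) ?S)"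
    using D(1) S(1) by (simp_all add: pred_def)
  \<comment> \<open>Under the joint guard both inner conditionals take their first branch, so the
    default 0 never enters and this function is the statistic. In the other branch
    \<open>undefined\<close> is a fixed real, hence a measurable constant.\<close>
  have "(\<lambda>Y. if min_exists (?l Y) ?D \<and> min_exists (?l Y) ?S then ?v ?D Y - ?v ?S Y else undefined)
      \<in> borel_measurable borel"
    by measurable
  then show ?thesis
    by (rule measurable_cong[THEN iffD1, rotated]) (simp add: lr_statistic_def Let_def)
qed

section \<open>Invariance of the statistic under diagonal scaling\<close>

lemma min_exists_translate:
  fixes f g :: "_ \<Rightarrow> real"
  assumes "\<phi> ` S = S'" and "\<And>x. x \<in> S \<Longrightarrow> g (\<phi> x) = f x + c"
  shows "min_exists g S' \<longleftrightarrow> min_exists f S"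
  unfolding min_exists_iff assms(1)[symmetric] by (simp add: assms(2))

text \<open>A reparametrization that shifts the objective by a constant carries minimizers to
  minimizers.\<close>

lemma min_value_translate:
  fixes f g :: "_ \<Rightarrow> real"
  assumes "\<phi> ` S = S'" and "\<And>x. x \<in> S \<Longrightarrow> g (\<phi> x) = f x + c" and "min_exists f S"
  shows "min_value g S' = min_value f S + c"
proof -
  obtain x where x: "x \<in> S" "\<And>y. y \<in> S \<Longrightarrow> f x \<le> f y"
    using assms(3) by (auto simp: min_exists_iff)
  then have "min_value f S = f x"
    by (rule min_value_eqI)
  moreover have "min_value g S' = g (\<phi> x)"
    by (rule min_value_eqI) (use x assms(1,2) in auto)
  ultimately show ?thesis
    using x assms(2) by simp
qed

definition diag_mat :: "real^'m \<Rightarrow> real^'m^'m" where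
  "diag_mat a = (\<chi> i j. if i = j then a $ i else 0)"

lemma diag_mat_mult: "(diag_mat a ** X) $ i $ j = a $ i * X $ i $ j"
  by (simp add: matrix_matrix_mult_def diag_mat_def if_distrib if_distribR cong: if_cong)

lemma mult_diag_mat: "(X ** diag_mat a) $ i $ j = X $ i $ j * a $ j"
  by (simp add: matrix_matrix_mult_def diag_mat_def if_distrib if_distribR cong: if_cong)

lemma transpose_diag_mat [simp]: "transpose (diag_mat a) = diag_mat a"
  by (simp add: vec_eq_iff transpose_def diag_mat_def)

lemma diag_mat_inverse:
  assumes "\<And>i. a $ i \<noteq> 0"
  shows "diag_mat a ** diag_mat (\<chi> i. inverse (a $ i)) = mat 1"
    and "diag_mat (\<chi> i. inverse (a $ i)) ** diag_mat a = mat 1"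
  unfolding vec_eq_iff diag_mat_mult using assms by (simp_all add: diag_mat_def mat_def)

text \<open>The new quadratic form is the old one evaluated at \<open>diag_mat a *v x\<close>, which
  is nonzero when \<open>x\<close> is, by invertibility.\<close>

lemma pos_def_congruence:
  assumes X: "X \<in> pos_def_matrices" and a: "\<And>i. a $ i \<noteq> 0"
  shows "diag_mat a ** X ** diag_mat a \<in> pos_def_matrices"
proof -
  have sym: "transpose X = X"
    using X by (simp add: pos_def_matrices_def)
  have "x \<bullet> ((diag_mat a ** X ** diag_mat a) *v x) > 0" if "x \<noteq> 0" for x
  proof -
    have "diag_mat a *v x \<noteq> 0"
      using that diag_mat_inverse(2)[OF a] by (metis matrix_vector_mul_assoc matrix_vector_mul_lid matrix_vector_mult_0_right)
    then have "(diag_mat a *v x) \<bullet> (X *v (diag_mat a *v x)) > 0"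
      using X by (simp add: pos_def_matrices_def)
    then show ?thesis
      by (metis dot_lmul_matrix matrix_vector_mul_assoc transpose_diag_mat vector_transpose_matrix)
  qed
  then show ?thesis
    by (simp add: pos_def_matrices_def matrix_transpose_mul sym matrix_mul_assoc)
qed

lemma pos_diag_congruence:
  assumes X: "X \<in> pos_diag_matrices" and a: "\<And>i. a $ i \<noteq> 0"
  shows "diag_mat a ** X ** diag_mat a \<in> pos_diag_matrices"
proof -
  have "a $ i * X $ i $ i * a $ i > 0" for i
  proof -
    have "X $ i $ i * (a $ i)\<^sup>2 > 0"
      using X a[of i] by (simp add: pos_diag_matrices_def)
    then show ?thesis
      by (simp add: power2_eq_square mult_ac)
  qed
  then show ?thesis
    using X by (simp add: pos_diag_matrices_def diag_mat_mult mult_diag_mat)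
qed

text \<open>In the trace the scalings cancel by cyclicity. In the determinant the inverse scalings
  stand on both sides of the Kronecker product, whence the factor 2. The additive constant depends
  on \<open>a\<close> and \<open>b\<close> alone.\<close>

lemma scaled_loglik_congruence:
  fixes Y :: "real^'m^'m"
  assumes a: "\<And>i. a $ i \<noteq> 0" and b: "\<And>i. b $ i \<noteq> 0"
    and S1: "det \<Sigma>1 \<noteq> 0" and S2: "det \<Sigma>2 \<noteq> 0"
  shows "scaled_loglik (diag_mat a ** \<Sigma>1 ** diag_mat a) (diag_mat b ** \<Sigma>2 ** diag_mat b)
      (diag_mat a ** Y ** diag_mat b)
    = scaled_loglik \<Sigma>1 \<Sigma>2 Y + - 2 * ln (det (kronecker (diag_mat (\<chi> i. inverse (b $ i)))
      (diag_mat (\<chi> i. inverse (a $ i)))))"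
proof -
  define A B A' B' where AB: "A = diag_mat a" "B = diag_mat b"
    "A' = diag_mat (\<chi> i. inverse (a $ i))" "B' = diag_mat (\<chi> i. inverse (b $ i))"
  define P Q where PQ: "P = matrix_inv \<Sigma>1" "Q = matrix_inv \<Sigma>2"
  have inv: "A ** A' = mat 1" "A' ** A = mat 1" "B ** B' = mat 1" "B' ** B = mat 1"
    using diag_mat_inverse[OF a] diag_mat_inverse[OF b] by (simp_all add: AB)
  have sym: "transpose A = A" "transpose B = B"
    by (simp_all add: AB)
  \<comment> \<open>\<open>matrix_mul_assoc\<close> brackets products to the left, so adjacent
    inverse factors are seen by the simplifier only behind a common left factor
    \<open>X\<close>.\<close>
  have cancel: "X ** A ** A' = X" "X ** A' ** A = X" "X ** B ** B' = X" "X ** B' ** B = X" for X :: "real^'m^'m"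
    by (simp_all add: inv flip: matrix_mul_assoc)
  have cancel': "X ** \<Sigma>1 ** P = X" "X ** \<Sigma>2 ** Q = X" for X :: "real^'m^'m"
    by (simp_all add: PQ matrix_inv_right S1 S2 flip: matrix_mul_assoc)
  have invS: "matrix_inv (A ** \<Sigma>1 ** A) = A' ** P ** A'" "matrix_inv (B ** \<Sigma>2 ** B) = B' ** Q ** B'"
    by (rule matrix_inv_eqI, simp add: matrix_mul_assoc cancel cancel' inv)+
  have tr: "trace (A' ** P ** A' ** (A ** Y ** B) ** (B' ** Q ** B') ** transpose (A ** Y ** B))
      = trace (P ** Y ** Q ** transpose Y)"
  proof -
    have "trace (A' ** P ** A' ** (A ** Y ** B) ** (B' ** Q ** B') ** transpose (A ** Y ** B))
        = trace (A' ** (P ** Y ** Q ** transpose Y ** A))"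
      by (simp add: matrix_transpose_mul sym matrix_mul_assoc cancel)
    also have "\<dots> = trace (P ** Y ** Q ** transpose Y ** A ** A')"
      by (rule trace_mul_sym)
    finally show ?thesis
      by (simp add: cancel)
  qed
  \<comment> \<open>The determinant may be negative here, since the entries of \<open>a\<close> and
    \<open>b\<close> are only nonzero. The real \<open>ln\<close> of a negative number is that of
    its absolute value, so the product rule still applies to nonzero factors.\<close>
  have "det (kronecker B' A') \<noteq> 0"
    using inv by (intro det_kronecker_nonzero) (metis det_nonzeroI)+
  moreover have "det (kronecker Q P) \<noteq> 0"
    unfolding PQ by (intro det_kronecker_nonzero det_matrix_inv_nonzero S1 S2)
  moreover have "kronecker (B' ** Q ** B') (A' ** P ** A') = kronecker B' A' ** kronecker Q P ** kronecker B' A'"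
    by (simp add: kronecker_mult)
  ultimately have "ln (det (kronecker (B' ** Q ** B') (A' ** P ** A')))
      = ln (det (kronecker Q P)) + 2 * ln (det (kronecker B' A'))"
    by (simp add: det_mul ln_mult)
  then show ?thesis
    unfolding scaled_loglik_def by (simp add: tr invS flip: AB PQ)
qed

lemma lr_statistic_congruence:
  fixes Y :: "real^'m^'m"
  assumes a: "\<And>i. a $ i \<noteq> 0" and b: "\<And>i. b $ i \<noteq> 0"
  shows "lr_statistic (diag_mat a ** Y ** diag_mat b) = lr_statistic Y"
proof -
  define \<phi> where "\<phi> = (\<lambda>(X :: real^'m^'m, Z :: real^'m^'m).
    (diag_mat a ** X ** diag_mat a, diag_mat b ** Z ** diag_mat b))"
  let ?l = "\<lambda>Y (A, B). scaled_loglik A B (Y :: real^'m^'m)"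
  let ?D = "pos_diag_matrices \<times> pos_diag_matrices :: ((real^'m^'m) \<times> (real^'m^'m)) set"
  let ?S = "pos_def_matrices \<times> pos_def_matrices :: ((real^'m^'m) \<times> (real^'m^'m)) set"
  let ?Y = "diag_mat a ** Y ** diag_mat b"
  define c where "c = - 2 * ln (det (kronecker (diag_mat (\<chi> i. inverse (b $ i)))
      (diag_mat (\<chi> i. inverse (a $ i)))))"
  \<comment> \<open>Closure under every invertible diagonal congruence already gives surjectivity: a
    preimage is the congruence by the inverse entries.\<close>
  have onto: "\<phi> ` (R \<times> R) = R \<times> R"
    if R: "\<And>d X. (\<And>i. d $ i \<noteq> 0) \<Longrightarrow> X \<in> R \<Longrightarrow> diag_mat d ** X ** diag_mat d \<in> R" for R
  proof -
    have surj: "\<exists>X'\<in>R. X = diag_mat d ** X' ** diag_mat d" if d: "\<And>i. d $ i \<noteq> 0" and X: "X \<in> R" for d X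
    proof
      let ?d = "\<chi> i. inverse (d $ i)"
      show "diag_mat ?d ** X ** diag_mat ?d \<in> R"
        by (rule R) (use d X in auto)
      show "X = diag_mat d ** (diag_mat ?d ** X ** diag_mat ?d) ** diag_mat d"
        using diag_mat_inverse[OF d] by (metis matrix_mul_assoc matrix_mul_lid matrix_mul_rid)
    qed
    show ?thesis
    proof (intro equalityI subsetI)
      fix z assume "z \<in> \<phi> ` (R \<times> R)"
      then show "z \<in> R \<times> R"
        using R a b by (auto simp: \<phi>_def)
    next
      fix z assume "z \<in> R \<times> R"
      then obtain X X' where "X \<in> R" "X' \<in> R" "z = \<phi> (X, X')"
        using surj[OF a, of "fst z"] surj[OF b, of "snd z"] by (auto simp: \<phi>_def)
      then show "z \<in> \<phi> ` (R \<times> R)"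
        by blast
    qed
  qed
  have lS: "?l ?Y (\<phi> p) = ?l Y p + c" if "p \<in> ?S" for p
    using that scaled_loglik_congruence[OF a b, of "fst p" "snd p" Y]
    by (auto simp: \<phi>_def c_def pos_def_det_nonzero)
  \<comment> \<open>Diagonal parameters are positive definite, so the same \<open>c\<close> serves
    for both minima and cancels in their difference.\<close>
  then have lD: "?l ?Y (\<phi> p) = ?l Y p + c" if "p \<in> ?D" for p
    using that by (auto simp: pos_diag_eq_pos_def_Int)
  have D: "\<phi> ` ?D = ?D" and S: "\<phi> ` ?S = ?S"
    by (intro onto pos_diag_congruence pos_def_congruence; assumption)+
  \<comment> \<open>Existence is transferred in both directions, so the two statistics also agree
    where a minimum is missing: both are then \<open>undefined\<close>.\<close>
  have "min_exists (?l ?Y) ?D \<longleftrightarrow> min_exists (?l Y) ?D" "min_exists (?l ?Y) ?S \<longleftrightarrow> min_exists (?l Y) ?S"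
    by (rule min_exists_translate[where \<phi> = \<phi>], fact, fact)+
  moreover have "min_value (?l ?Y) ?D = min_value (?l Y) ?D + c" if "min_exists (?l Y) ?D"
    by (rule min_value_translate[where \<phi> = \<phi>]) (fact D, fact lD, fact that)
  moreover have "min_value (?l ?Y) ?S = min_value (?l Y) ?S + c" if "min_exists (?l Y) ?S"
    by (rule min_value_translate[where \<phi> = \<phi>]) (fact S, fact lS, fact that)
  ultimately show ?thesis
    unfolding lr_statistic_def Let_def by simp
qed

text \<open>Diagonal factors act entry by entry, multiplying entry \<open>(i, j)\<close> by
  \<open>a $ i * b $ j\<close>, so zeros stay zeros.\<close>

lemma zero_diagonal_congruence:
  "zero_diagonal (diag_mat a ** Y ** diag_mat b) = diag_mat a ** zero_diagonal Y ** diag_mat b"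
  by (simp add: vec_eq_iff zero_diagonal_def diag_mat_mult mult_diag_mat)

section \<open>Scaling the standard normal law\<close>

lemma det_diag_mat: "det (diag_mat a) = (\<Prod>i\<in>UNIV. a $ i)"
  by (subst det_diagonal) (auto simp: diag_mat_def)

lemma prod_Basis_vec:
  fixes f :: "real^'n \<Rightarrow> 'a::comm_monoid_mult"
  shows "(\<Prod>b\<in>Basis. f b) = (\<Prod>i\<in>UNIV. f (axis i 1))"
proof -
  have "(Basis :: (real^'n) set) = (\<lambda>i. axis i 1) ` UNIV"
    by (auto simp: Basis_vec_def)
  moreover have "inj (\<lambda>i::'n. axis i (1::real))"
    by (simp add: inj_on_def axis_eq_axis)
  ultimately show ?thesis
    by (metis (no_types, lifting) prod.reindex comp_def prod.cong)
qed

text \<open>Change of variables under a coordinatewise scaling. The Jacobian \<open>C\<close> is the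
  product of the standard deviations, hence also the square root of the determinant of the
  covariance, and it cancels against the normalizing constant.\<close>

lemma density_mvn_scaling:
  fixes c :: "real^'n"
  assumes c: "\<And>i. c $ i > 0"
  shows "density lborel (mvn_density 0 (diag_mat (\<chi> i. (c $ i)\<^sup>2)))
    = distr (density lborel (mvn_density 0 (mat 1))) borel ((*v) (diag_mat c))"
proof -
  let ?s = "(*v) (diag_mat c)"
  let ?f = "\<lambda>x. ennreal (mvn_density 0 (diag_mat (\<chi> i. (c $ i)\<^sup>2)) x)"
  have diag_nth: "(diag_mat d *v x) $ i = d $ i * x $ i" for d x :: "real^'n" and i
    by (simp add: matrix_vector_mult_def diag_mat_def if_distrib if_distribR cong: if_cong)
  \<comment> \<open>The coordinate form in which \<open>lborel_affine_euclidean\<close> expects the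
    map, with zero translation.\<close>
  have s_sum: "?s = (\<lambda>x. 0 + (\<Sum>j\<in>Basis. ((c \<bullet> j) * (x \<bullet> j)) *\<^sub>R j))"
    by (rule ext, simp add: euclidean_eq_iff[where 'a="real^'n"])
      (auto simp: Basis_vec_def inner_axis diag_nth)
  define C where "C = (\<Prod>i\<in>UNIV. c $ i)"
  have C: "C > 0"
    by (simp add: C_def prod_pos c)
  have "c \<bullet> j \<noteq> 0" if "j \<in> Basis" for j
    using that c by (auto simp: Basis_vec_def inner_axis less_imp_neq[THEN not_sym])
  moreover have "(\<Prod>j\<in>Basis. \<bar>c \<bullet> j\<bar>) = C"
    unfolding prod_Basis_vec C_def using c by (simp add: inner_axis less_imp_le)
  ultimately have lborel: "(lborel :: (real^'n) measure) = density (distr lborel borel ?s) (\<lambda>_. ennreal C)"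
    using lborel_affine_euclidean[of "\<lambda>j. c \<bullet> j" 0] unfolding s_sum by simp
  have [measurable]: "?s \<in> borel_measurable borel"
    by (intro borel_measurable_continuous_onI) (simp add: matrix_vector_mult_def continuous_intros)
  have [measurable]: "?f \<in> borel_measurable borel"
    unfolding mvn_density_def matrix_vector_mult_def
    by (intro measurable_compose[OF _ measurable_ennreal] borel_measurable_continuous_onI
        continuous_intros) (simp_all add: det_diag_mat c[THEN less_imp_neq, THEN not_sym])
  have inv: "matrix_inv (diag_mat (\<chi> i. (c $ i)\<^sup>2)) = diag_mat (\<chi> i. inverse ((c $ i)\<^sup>2))"
    using diag_mat_inverse(1)[of "\<chi> i. (c $ i)\<^sup>2"] c
    by (intro matrix_inv_eqI) (simp add: less_imp_neq[THEN not_sym])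
  have inv1: "matrix_inv (mat 1 :: real^'n^'n) = mat 1"
    by (rule matrix_inv_eqI) simp
  \<comment> \<open>The inverse variances undo the squared scaling, leaving the exponent of the
    standard normal density.\<close>
  have quad: "?s x \<bullet> (matrix_inv (diag_mat (\<chi> i. (c $ i)\<^sup>2)) *v ?s x) = x \<bullet> x" for x
    unfolding inv inner_vec_def diag_nth
    using c by (intro sum.cong) (auto simp: field_simps power2_eq_square less_imp_neq[THEN not_sym])
  have "det (diag_mat (\<chi> i. (c $ i)\<^sup>2)) = C\<^sup>2"
    by (simp add: det_diag_mat C_def prod_power_distrib)
  then have "C * mvn_density 0 (diag_mat (\<chi> i. (c $ i)\<^sup>2)) (?s x) = mvn_density 0 (mat 1) x" for x
    using C by (simp add: mvn_density_def quad inv1 real_sqrt_mult)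
  then have dens: "ennreal C * ?f (?s x) = ennreal (mvn_density 0 (mat 1) x)" for x
    using C by (metis ennreal_mult' less_imp_le)
  have "density lborel ?f = density (density (distr lborel borel ?s) (\<lambda>_. ennreal C)) ?f"
    using lborel by simp
  also have "\<dots> = density (distr lborel borel ?s) (\<lambda>x. ennreal C * ?f x)"
    by (rule density_density_eq) simp_all
  also have "\<dots> = distr (density lborel (\<lambda>x. ennreal C * ?f (?s x))) borel ?s"
    by (rule density_distr) simp_all
  finally show ?thesis
    by (simp add: dens)
qed

section \<open>The statistic as a function of the stacked vector, whose law is given\<close>

definition unvectorize :: "real^('n \<times> 'm) \<Rightarrow> real^'n^'m" where
  "unvectorize v = (\<chi> i j. v $ (j, i))"

lemma unvectorize_vectorize [simp]: "unvectorize (vectorize Y) = Y"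
  by (simp add: unvectorize_def vectorize_def)

text \<open>Unstacking followed by zeroing the diagonal is continuous, since each entry is either
  constantly 0 or a coordinate of \<open>v\<close>.\<close>

lemma borel_measurable_lr_statistic_zero_diagonal:
  "(\<lambda>v. lr_statistic (zero_diagonal (unvectorize v :: real^'m^'m))) \<in> borel_measurable borel"
proof -
  have entry: "continuous_on UNIV (\<lambda>v. if i = j then 0 else v $ (j, i) :: real)" for i j :: 'm
    by (cases "i = j") (auto intro!: continuous_intros)
  have eq: "zero_diagonal (unvectorize v) = (\<chi> i j. if i = j then 0 else v $ (j, i))" for v :: "real^('m \<times> 'm)"
    by (simp add: vec_eq_iff zero_diagonal_def unvectorize_def)
  have "continuous_on UNIV (\<lambda>v. zero_diagonal (unvectorize v :: real^'m^'m))"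
    unfolding eq by (intro continuous_on_vec_lambda entry)
  then show ?thesis
    by (intro measurable_compose[OF _ borel_measurable_lr_statistic] borel_measurable_continuous_onI)
qed

theorem mainTheorem5:
  fixes M :: "'a measure" and M0 :: "'b measure"
    and Dr Dc :: "real^'m^'m"
    and Y :: "'a \<Rightarrow> real^'m^'m" and Y0 :: "'b \<Rightarrow> real^'m^'m"
  assumes "CARD('m) \<ge> 2"
    and "prob_space M" and "prob_space M0"
    and "Dr \<in> pos_diag_matrices" and "Dc \<in> pos_diag_matrices"
    and "matrix_normal M Y 0 Dr Dc"
    and "matrix_normal M0 Y0 0 (mat 1) (mat 1)"
  shows "(\<lambda>\<omega>. lr_statistic (zero_diagonal (Y \<omega>))) \<in> borel_measurable M
    \<and> (\<lambda>\<omega>. lr_statistic (zero_diagonal (Y0 \<omega>))) \<in> borel_measurable M0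
    \<and> distr M borel (\<lambda>\<omega>. lr_statistic (zero_diagonal (Y \<omega>)))
      = distr M0 borel (\<lambda>\<omega>. lr_statistic (zero_diagonal (Y0 \<omega>)))"
proof -
  let ?T = "\<lambda>v. lr_statistic (zero_diagonal (unvectorize v :: real^'m^'m))"
  note T [measurable] = borel_measurable_lr_statistic_zero_diagonal
  \<comment> \<open>Square roots, because variances scale quadratically. In the stacking order the
    pair \<open>(j, i)\<close> is row \<open>i\<close> of column \<open>j\<close>, so
    \<open>c\<close> holds the standard deviation \<open>b $ j * a $ i\<close> there.\<close>
  define a b where "a = (\<chi> i. sqrt (Dr $ i $ i))" and "b = (\<chi> j. sqrt (Dc $ j $ j))"
  define c where "c = (\<chi> p. b $ fst p * a $ snd p)"
  have a: "a $ i > 0" and b: "b $ i > 0" for i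
    using assms(4,5) by (simp_all add: a_def b_def pos_diag_matrices_def)
  then have c: "c $ p > 0" for p
    by (simp add: c_def)
  have Dr: "Dr $ i $ j = (if i = j then (a $ i)\<^sup>2 else 0)" and Dc: "Dc $ i $ j = (if i = j then (b $ i)\<^sup>2 else 0)" for i j
    using assms(4,5) by (auto simp: a_def b_def pos_diag_matrices_def less_imp_le)
  have cov: "kronecker Dc Dr = diag_mat (\<chi> p. (c $ p)\<^sup>2)"
    by (auto simp: vec_eq_iff kronecker_def diag_mat_def c_def Dr Dc power_mult_distrib prod_eq_iff)
  have mean: "vectorize 0 = (0 :: real^('m \<times> 'm))"
    by (simp add: vec_eq_iff vectorize_def)
  note N = assms(6,7)[unfolded matrix_normal_def distributed_def mean cov kronecker_mat_1]
  have Y: "(\<lambda>\<omega>. vectorize (Y \<omega>)) \<in> measurable M lborel"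
    and Y0: "(\<lambda>\<omega>. vectorize (Y0 \<omega>)) \<in> measurable M0 lborel"
    using N by auto
  have T_meas: "?T \<in> measurable lborel borel"
    by simp
  have "(diag_mat c *v v) $ p = c $ p * v $ p" for v p
    by (simp add: matrix_vector_mult_def diag_mat_def if_distrib if_distribR cong: if_cong)
  \<comment> \<open>Scaling the stacked vector by \<open>c\<close> is the two-sided action on
    matrices, under which the statistic is invariant.\<close>
  then have "unvectorize (diag_mat c *v v) = diag_mat a ** unvectorize v ** diag_mat b" for v
    by (simp add: vec_eq_iff diag_mat_mult mult_diag_mat unvectorize_def c_def)
  then have T_scale: "?T (diag_mat c *v v) = ?T v" for v
    using lr_statistic_congruence[of a b] a b
    by (simp add: zero_diagonal_congruence less_imp_neq[THEN not_sym])
  have "distr M borel (\<lambda>\<omega>. ?T (vectorize (Y \<omega>))) = distr (distr M lborel (\<lambda>\<omega>. vectorize (Y \<omega>))) borel ?T"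
    by (simp add: distr_distr[OF T_meas Y] comp_def)
  also have "\<dots> = distr (density lborel (mvn_density 0 (diag_mat (\<chi> p. (c $ p)\<^sup>2)))) borel ?T"
    using N by simp
  also have "\<dots> = distr (distr (density lborel (mvn_density 0 (mat 1))) borel ((*v) (diag_mat c))) borel ?T"
    by (simp add: density_mvn_scaling[OF c])
  also have "\<dots> = distr (density lborel (mvn_density 0 (mat 1))) borel (\<lambda>v. ?T (diag_mat c *v v))"
    by (subst distr_distr) (auto simp: comp_def matrix_vector_mult_def
        intro!: borel_measurable_continuous_onI continuous_intros)
  \<comment> \<open>Here \<open>T_scale\<close> removes the scaling, and only the standard law of
    the second matrix remains.\<close>
  also have "\<dots> = distr (distr M0 lborel (\<lambda>\<omega>. vectorize (Y0 \<omega>))) borel ?T"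
    using N by (simp add: T_scale)
  also have "\<dots> = distr M0 borel (\<lambda>\<omega>. ?T (vectorize (Y0 \<omega>)))"
    by (simp add: distr_distr[OF T_meas Y0] comp_def)
  finally show ?thesis
    using measurable_compose[OF Y T_meas] measurable_compose[OF Y0 T_meas] by simp
qed

end
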